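(* Let $(G,\mu)$ be a measured group and denote by $(B,m)$ and $(\check B,\check m)$ the Poisson boundaries of $(G,\mu)$ and $(G,\check\mu)$ respectively. If $(Y,\eta)$ is any ergodic probability measure preserving $G$-space, then the diagonal $G$-action on $(B\times\check B\times Y,\ m\otimes\check m\otimes\eta)$ is ergodic.
   Context: A measured group $(G,\mu)$ is a countable group $G$ together with a probability measure $\mu$ on $G$ whose support generates $G$ as a semigroup; $\check\mu(g)=\mu(g^{-1})$. A $(G,\mu)$-space is a (standard) Borel probability space $(X,\nu)$ with an action of $G$ by bi-measurable maps, each preserving the measure class of $\nu$, such that $$\int_G\int_X\phi(g^{-1}x)\,d\nu(x)\,d\mu(g)=\int_X\phi\,d\nu\quad\text{for all }\phi\in L^\infty(X,\nu).$$ An action of $G$ preserving the measure class of a probability measure is ergodic if every $G$-invariant measurable set is null or conull. The Poisson boundary of $(G,\mu)$ is an ergodic $(G,\mu)$-space $(B,m)$ for which the Poisson transform $P\phi(g)=\int_B\phi(g^{-1}b)\,dm(b)$, $g\in G$, is an isometric isomorphism of $L^\infty(B,m)$ onto the space (with supremum norm) of all bounded functions $f$ on $G$ satisfying $f(g)=\int_G f(sg)\,d\mu(s)$ for all $g\in G$. The Poisson boundary $(\check B,\check m)$ of $(G,\check\mu)$ is defined in the same way with $\check\mu$ in place of $\mu$. A probability measure preserving $G$-space is a (standard) Borel probability space with a measurable $G$-action preserving the measure. *)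

theory Defs
  imports "HOL-Probability.Probability" "HOL-Algebra.Group_Action"
begin

inductive_set semigroup_generated :: "('g, 'z) monoid_scheme \<Rightarrow> 'g set \<Rightarrow> 'g set"
  for G and S where
  incl: "s \<in> S \<Longrightarrow> s \<in> semigroup_generated G S"
| mult: "a \<in> semigroup_generated G S \<Longrightarrow> b \<in> semigroup_generated G S
          \<Longrightarrow> a \<otimes>\<^bsub>G\<^esub> b \<in> semigroup_generated G S"

text \<open>Since the group is countable, a probability measure on it is a probability mass function
  supported in the carrier.\<close>

definition measured_group :: "('g, 'z) monoid_scheme \<Rightarrow> 'g pmf \<Rightarrow> bool" where
  "measured_group G \<mu> \<longleftrightarrow>
     group G \<and> countable (carrier G) \<and> set_pmf \<mu> \<subseteq> carrier G \<and>
     semigroup_generated G (set_pmf \<mu>) = carrier G"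

definition reflected_pmf :: "('g, 'z) monoid_scheme \<Rightarrow> 'g pmf \<Rightarrow> 'g pmf" where
  "reflected_pmf G \<mu> = map_pmf (\<lambda>g. inv\<^bsub>G\<^esub> g) \<mu>"

lemma pmf_reflected_pmf:
  assumes "measured_group G \<mu>" and g: "g \<in> carrier G"
  shows "pmf (reflected_pmf G \<mu>) g = pmf \<mu> (inv\<^bsub>G\<^esub> g)"
proof -
  interpret group G using assms by (simp add: measured_group_def)
  have sub: "set_pmf \<mu> \<subseteq> carrier G" using assms by (simp add: measured_group_def)
  have "pmf (reflected_pmf G \<mu>) g = measure (measure_pmf \<mu>) ((\<lambda>h. inv\<^bsub>G\<^esub> h) -` {g})"
    by (simp add: reflected_pmf_def pmf_map)
  also have "\<dots> = measure (measure_pmf \<mu>) {inv\<^bsub>G\<^esub> g}"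
    by (rule measure_pmf.finite_measure_eq_AE) (use sub g in \<open>auto intro!: AE_pmfI\<close>)
  finally show ?thesis by (simp add: pmf.rep_eq)
qed

definition standard_borel :: "'x measure \<Rightarrow> bool" where
  "standard_borel M \<longleftrightarrow>
     (\<exists>T. completely_metrizable_space T \<and> separable_space T \<and> topspace T = space M \<and>
          sets M = sigma_sets (topspace T) {U. openin T U})"

text \<open>An action in the sense of \<^locale>\<open>group_action\<close> is a homomorphism into the group of
  bijections of \<^term>\<open>space M\<close>, represented by extensional functions.
  Each map is bi-measurable because the maps of both \<open>g\<close> and its inverse are measurable.\<close>

definition measurable_action ::
    "('g, 'z) monoid_scheme \<Rightarrow> 'x measure \<Rightarrow> ('g \<Rightarrow> 'x \<Rightarrow> 'x) \<Rightarrow> bool" where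
  "measurable_action G M \<alpha> \<longleftrightarrow>
     group_action G (space M) \<alpha> \<and> (\<forall>g\<in>carrier G. \<alpha> g \<in> M \<rightarrow>\<^sub>M M)"

definition measure_class_preserving ::
    "('g, 'z) monoid_scheme \<Rightarrow> 'x measure \<Rightarrow> ('g \<Rightarrow> 'x \<Rightarrow> 'x) \<Rightarrow> bool" where
  "measure_class_preserving G M \<alpha> \<longleftrightarrow>
     measurable_action G M \<alpha> \<and> (\<forall>g\<in>carrier G. null_sets (distr M M (\<alpha> g)) = null_sets M)"

definition measure_preserving_action ::
    "('g, 'z) monoid_scheme \<Rightarrow> 'x measure \<Rightarrow> ('g \<Rightarrow> 'x \<Rightarrow> 'x) \<Rightarrow> bool" where
  "measure_preserving_action G M \<alpha> \<longleftrightarrow>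
     measurable_action G M \<alpha> \<and> (\<forall>g\<in>carrier G. distr M M (\<alpha> g) = M)"

definition ergodic_action ::
    "('g, 'z) monoid_scheme \<Rightarrow> 'x measure \<Rightarrow> ('g \<Rightarrow> 'x \<Rightarrow> 'x) \<Rightarrow> bool" where
  "ergodic_action G M \<alpha> \<longleftrightarrow>
     prob_space M \<and> measure_class_preserving G M \<alpha> \<and>
     (\<forall>A\<in>sets M. (\<forall>g\<in>carrier G. \<alpha> g ` A = A) \<longrightarrow>
        A \<in> null_sets M \<or> space M - A \<in> null_sets M)"

text \<open>Representatives of the classes in \<open>L\<^sup>\<infinity>\<close>; the norm is a seminorm on representatives which
  vanishes exactly on the functions that are zero almost everywhere.\<close>

definition Linfty_norm :: "'x measure \<Rightarrow> ('x \<Rightarrow> real) \<Rightarrow> ereal" where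
  "Linfty_norm M \<phi> = esssup M (\<lambda>x. ereal \<bar>\<phi> x\<bar>)"

definition Linfty :: "'x measure \<Rightarrow> ('x \<Rightarrow> real) set" where
  "Linfty M = {\<phi> \<in> borel_measurable M. Linfty_norm M \<phi> < \<infinity>}"

definition measured_group_space ::
    "('g, 'z) monoid_scheme \<Rightarrow> 'g pmf \<Rightarrow> 'x measure \<Rightarrow> ('g \<Rightarrow> 'x \<Rightarrow> 'x) \<Rightarrow> bool" where
  "measured_group_space G \<mu> M \<alpha> \<longleftrightarrow>
     standard_borel M \<and> prob_space M \<and> measure_class_preserving G M \<alpha> \<and>
     (\<forall>\<phi>\<in>Linfty M.
        (\<integral>g. (\<integral>x. \<phi> (\<alpha> (inv\<^bsub>G\<^esub> g) x) \<partial>M) \<partial>measure_pmf \<mu>) = (\<integral>x. \<phi> x \<partial>M))"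

text \<open>Functions on the group are taken extensional on the carrier, so that equality of functions
  is equality on the carrier.\<close>

definition bounded_harmonic :: "('g, 'z) monoid_scheme \<Rightarrow> 'g pmf \<Rightarrow> ('g \<Rightarrow> real) set" where
  "bounded_harmonic G \<mu> =
     {f \<in> extensional (carrier G). bounded (f ` carrier G) \<and>
        (\<forall>g\<in>carrier G. f g = (\<integral>s. f (s \<otimes>\<^bsub>G\<^esub> g) \<partial>measure_pmf \<mu>))}"

definition sup_norm :: "('g, 'z) monoid_scheme \<Rightarrow> ('g \<Rightarrow> real) \<Rightarrow> ereal" where
  "sup_norm G f = (SUP g\<in>carrier G. ereal \<bar>f g\<bar>)"

definition poisson_transform ::
    "('g, 'z) monoid_scheme \<Rightarrow> 'x measure \<Rightarrow> ('g \<Rightarrow> 'x \<Rightarrow> 'x) \<Rightarrow> ('x \<Rightarrow> real) \<Rightarrow> 'g \<Rightarrow> real" where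
  "poisson_transform G M \<alpha> \<phi> = (\<lambda>g\<in>carrier G. \<integral>b. \<phi> (\<alpha> (inv\<^bsub>G\<^esub> g) b) \<partial>M)"

text \<open>Injectivity on almost everywhere classes is part of the isometry clause, by linearity.\<close>

definition poisson_boundary ::
    "('g, 'z) monoid_scheme \<Rightarrow> 'g pmf \<Rightarrow> 'x measure \<Rightarrow> ('g \<Rightarrow> 'x \<Rightarrow> 'x) \<Rightarrow> bool" where
  "poisson_boundary G \<mu> M \<alpha> \<longleftrightarrow>
     measured_group_space G \<mu> M \<alpha> \<and> ergodic_action G M \<alpha> \<and>
     (\<forall>\<phi>\<in>Linfty M. \<forall>\<psi>\<in>Linfty M. \<forall>a b. \<forall>g\<in>carrier G.
        poisson_transform G M \<alpha> (\<lambda>x. a * \<phi> x + b * \<psi> x) g =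
        a * poisson_transform G M \<alpha> \<phi> g + b * poisson_transform G M \<alpha> \<psi> g) \<and>
     (\<forall>\<phi>\<in>Linfty M. sup_norm G (poisson_transform G M \<alpha> \<phi>) = Linfty_norm M \<phi>) \<and>
     poisson_transform G M \<alpha> ` Linfty M = bounded_harmonic G \<mu>"

definition pmp_space ::
    "('g, 'z) monoid_scheme \<Rightarrow> 'x measure \<Rightarrow> ('g \<Rightarrow> 'x \<Rightarrow> 'x) \<Rightarrow> bool" where
  "pmp_space G M \<alpha> \<longleftrightarrow>
     standard_borel M \<and> prob_space M \<and> measure_preserving_action G M \<alpha>"

definition diagonal_action ::
    "'x measure \<Rightarrow> ('g \<Rightarrow> 'x \<Rightarrow> 'x) \<Rightarrow> 'y measure \<Rightarrow> ('g \<Rightarrow> 'y \<Rightarrow> 'y) \<Rightarrow>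
     'w measure \<Rightarrow> ('g \<Rightarrow> 'w \<Rightarrow> 'w) \<Rightarrow> 'g \<Rightarrow> 'x \<times> 'y \<times> 'w \<Rightarrow> 'x \<times> 'y \<times> 'w" where
  "diagonal_action L \<alpha> M \<beta> N \<gamma> g =
     (\<lambda>(x, y, w)\<in>space L \<times> space M \<times> space N. (\<alpha> g x, \<beta> g y, \<gamma> g w))"

end

theory Submission
  imports Defs
begin

text \<open>Everything rests on one extension principle: if \<open>(B, m)\<close> is the Poisson boundary of
  \<open>(G, \<mu>)\<close>, and \<open>(X, \<xi>)\<close> is an ergodic space with \<open>\<Sum>g. \<mu>(g) \<integral>\<phi>(g x) d\<xi>(x) = \<integral>\<phi> d\<xi>\<close>,
  then \<open>B \<times> X\<close> is ergodic. Indeed, let \<open>A\<close> be an invariant set and \<open>\<Phi>(x) = m(A\<^sup>x)\<close> the measure of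
  its section. Invariance gives \<open>\<Phi>(g x) = P(1\<^bsub>A\<^sup>x\<^esub>)(g)\<close>, so \<open>\<Sum>g. \<mu>(g) \<Phi>(g x) = \<Phi>(x)\<close>; since \<open>\<xi>\<close> is
  stationary, the integrated variance \<open>\<integral>\<Sum>g. \<mu>(g) (\<Phi>(g x) - \<Phi>(x))\<^sup>2 d\<xi>(x)\<close> vanishes and \<open>\<Phi>\<close> is
  almost everywhere invariant. Hence the Poisson transform of \<open>1\<^bsub>A\<^sup>x\<^esub>\<close> is constant, so \<open>1\<^bsub>A\<^sup>x\<^esub>\<close> is
  almost everywhere constant and \<open>\<Phi>\<close> takes only the values 0 and 1; ergodicity of \<open>X\<close> finishes the
  argument. The principle is applied first to the boundary of the reflected measure and \<open>Y\<close>, then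
  to the boundary of \<open>\<mu>\<close> and the resulting product.\<close>

section \<open>Averages over the group and essentially bounded functions\<close>

text \<open>The support of \<open>p\<close> is countable, so measurability of each single
  \<open>f g\<close> already yields joint measurability, and Fubini applies. The type of group
  elements may be uncountable, hence the detour through the natural numbers.\<close>

lemma
  fixes f :: "'g \<Rightarrow> 'x \<Rightarrow> real"
  assumes "prob_space M"
    and meas: "\<And>g. g \<in> set_pmf p \<Longrightarrow> f g \<in> borel_measurable M"
    and bound: "\<And>g x. g \<in> set_pmf p \<Longrightarrow> x \<in> space M \<Longrightarrow> \<bar>f g x\<bar> \<le> C"
  shows borel_measurable_integral_pmf: "(\<lambda>x. \<integral>g. f g x \<partial>measure_pmf p) \<in> borel_measurable M"
    and integral_pmf_swap:
      "(\<integral>g. \<integral>x. f g x \<partial>M \<partial>measure_pmf p) = (\<integral>x. \<integral>g. f g x \<partial>measure_pmf p \<partial>M)"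
proof -
  interpret M: prob_space M by fact
  define q where "q = map_pmf (to_nat_on (set_pmf p)) p"
  \<comment> \<open>\<open>from_nat_into\<close> stays in the support at every natural number, even
    outside the enumeration, so the hypotheses on \<open>f\<close> hold at every index
    \<open>k n\<close>.\<close>
  define k where "k = from_nat_into (set_pmf p)"
  have k: "k n \<in> set_pmf p" for n
    unfolding k_def by (simp add: from_nat_into set_pmf_not_empty)
  have p: "p = map_pmf k q"
  proof -
    have "map_pmf k q = map_pmf (\<lambda>g. g) p"
      unfolding q_def k_def map_pmf_comp
      by (intro map_pmf_cong refl) (simp add: countable_set_pmf)
    then show ?thesis by (simp add: map_pmf_ident)
  qed
  interpret P: pair_prob_space "measure_pmf q" M ..
  have eq: "sets (measure_pmf q \<Otimes>\<^sub>M M) = sets (count_space UNIV \<Otimes>\<^sub>M M)"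
    by (intro sets_pair_measure_cong) simp_all
  have "(\<lambda>(n, x). f (k n) x) \<in> borel_measurable (count_space UNIV \<Otimes>\<^sub>M M)"
    by (rule measurable_pair_measure_countable1) (auto intro!: meas k)
  then have fk: "(\<lambda>(n, x). f (k n) x) \<in> borel_measurable (measure_pmf q \<Otimes>\<^sub>M M)"
    using measurable_cong_sets[OF eq refl] by blast
  then have int: "integrable (measure_pmf q \<Otimes>\<^sub>M M) (\<lambda>(n, x). f (k n) x)"
    by (intro P.integrable_const_bound[of _ C] AE_I2)
       (auto simp: space_pair_measure intro!: bound k)
  show "(\<lambda>x. \<integral>g. f g x \<partial>measure_pmf p) \<in> borel_measurable M"
    unfolding p integral_map_pmf
    using P.integrable_snd[OF int] by (rule borel_measurable_integrable)
  show "(\<integral>g. \<integral>x. f g x \<partial>M \<partial>measure_pmf p) = (\<integral>x. \<integral>g. f g x \<partial>measure_pmf p \<partial>M)"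
    unfolding p integral_map_pmf by (rule P.Fubini_integral[OF int, symmetric])
qed

lemma bounded_in_Linfty:
  assumes "\<phi> \<in> borel_measurable M" "\<And>x. x \<in> space M \<Longrightarrow> \<bar>\<phi> x\<bar> \<le> C"
  shows "\<phi> \<in> Linfty M"
proof -
  have "Linfty_norm M \<phi> \<le> ereal C"
    unfolding Linfty_norm_def using assms by (intro esssup_I) auto
  then show ?thesis using assms by (auto simp: Linfty_def)
qed

lemma Linfty_norm_eq_0_AE:
  assumes "Linfty_norm M \<phi> = 0"
  shows "AE x in M. \<phi> x = 0"
  using esssup_AE[of "\<lambda>x. ereal \<bar>\<phi> x\<bar>" M] assms by (simp add: Linfty_norm_def)

section \<open>Measurable actions and quasi-invariance\<close>

lemma measurable_actionD:
  assumes "measurable_action G M \<alpha>" "g \<in> carrier G"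
  shows "\<alpha> g \<in> M \<rightarrow>\<^sub>M M"
    and "x \<in> space M \<Longrightarrow> \<alpha> g x \<in> space M"
    and "h \<in> carrier G \<Longrightarrow> x \<in> space M \<Longrightarrow> \<alpha> (g \<otimes>\<^bsub>G\<^esub> h) x = \<alpha> g (\<alpha> h x)"
    and "x \<in> space M \<Longrightarrow> \<alpha> (inv\<^bsub>G\<^esub> g) (\<alpha> g x) = x"
    and "x \<in> space M \<Longrightarrow> \<alpha> g (\<alpha> (inv\<^bsub>G\<^esub> g) x) = x"
proof -
  interpret group_action G "space M" \<alpha> using assms by (simp add: measurable_action_def)
  interpret group G using group_hom by (rule group_hom.axioms)
  show "\<alpha> g \<in> M \<rightarrow>\<^sub>M M" using assms by (simp add: measurable_action_def)
  show "x \<in> space M \<Longrightarrow> \<alpha> g x \<in> space M" using element_image assms by blast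
  show "h \<in> carrier G \<Longrightarrow> x \<in> space M \<Longrightarrow> \<alpha> (g \<otimes>\<^bsub>G\<^esub> h) x = \<alpha> g (\<alpha> h x)"
    using composition_rule assms by blast
  show "x \<in> space M \<Longrightarrow> \<alpha> (inv\<^bsub>G\<^esub> g) (\<alpha> g x) = x" using orbit_sym_aux assms by blast
  show "x \<in> space M \<Longrightarrow> \<alpha> g (\<alpha> (inv\<^bsub>G\<^esub> g) x) = x"
    using orbit_sym_aux[of "inv\<^bsub>G\<^esub> g" x] assms by simp
qed

lemma group_actionI:
  assumes "group G"
    and ext: "\<And>g. g \<in> carrier G \<Longrightarrow> \<phi> g \<in> extensional E"
    and closed: "\<And>g x. g \<in> carrier G \<Longrightarrow> x \<in> E \<Longrightarrow> \<phi> g x \<in> E"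
    and mult: "\<And>g h x. g \<in> carrier G \<Longrightarrow> h \<in> carrier G \<Longrightarrow> x \<in> E \<Longrightarrow>
      \<phi> (g \<otimes>\<^bsub>G\<^esub> h) x = \<phi> g (\<phi> h x)"
    and inv: "\<And>g x. g \<in> carrier G \<Longrightarrow> x \<in> E \<Longrightarrow> \<phi> (inv\<^bsub>G\<^esub> g) (\<phi> g x) = x"
  shows "group_action G E \<phi>"
proof -
  interpret group G by fact
  have bij: "\<phi> g \<in> Bij E" if g: "g \<in> carrier G" for g
    unfolding Bij_def
  proof (intro IntI CollectI ext g bij_betwI[where g = "\<phi> (inv\<^bsub>G\<^esub> g)"])
    show "\<phi> g (\<phi> (inv\<^bsub>G\<^esub> g) y) = y" if "y \<in> E" for y
      using inv[of "inv\<^bsub>G\<^esub> g" y] g that by simp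
  qed (use g closed inv in auto)
  have hom: "\<phi> (g \<otimes>\<^bsub>G\<^esub> h) = compose E (\<phi> g) (\<phi> h)" if "g \<in> carrier G" "h \<in> carrier G" for g h
    using that by (intro extensionalityI[of _ E]) (auto simp: ext mult compose_eq)
  have "\<phi> \<in> hom G (BijGroup E)"
    by (rule homI) (auto simp: BijGroup_def bij hom)
  then show ?thesis
    using \<open>group G\<close>
    by (intro group_action.intro group_hom.intro group_hom_axioms.intro group_BijGroup)
qed

text \<open>Preimages of null sets under \<open>\<alpha> g\<close> are null. This allows an almost
  everywhere identity to be evaluated at translated points.\<close>

lemma measure_class_preserving_AE:
  assumes "measure_class_preserving G M \<alpha>" "g \<in> carrier G" "AE x in M. P x"
  shows "AE x in M. P (\<alpha> g x)"
proof -
  have m: "\<alpha> g \<in> M \<rightarrow>\<^sub>M M"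
    using assms measurable_actionD(1) by (fastforce simp: measure_class_preserving_def)
  obtain N where N: "N \<in> null_sets M" "{x \<in> space M. \<not> P x} \<subseteq> N"
    using assms(3) by (auto simp: eventually_ae_filter)
  then have "N \<in> null_sets (distr M M (\<alpha> g))"
    using assms by (simp add: measure_class_preserving_def)
  then have "\<alpha> g -` N \<inter> space M \<in> null_sets M"
    using m by (simp add: null_sets_distr_iff)
  then show ?thesis
    by (rule AE_I') (use N m in \<open>auto dest: measurable_space\<close>)
qed

section \<open>Diagonal actions on products\<close>

text \<open>Iterating this binary form gives the diagonal action on three factors, so one product
  argument can be used twice. The restriction supplies the extensionality that
  \<open>group_action\<close> demands.\<close>

definition prod_action ::
    "'x measure \<Rightarrow> ('g \<Rightarrow> 'x \<Rightarrow> 'x) \<Rightarrow> 'y measure \<Rightarrow> ('g \<Rightarrow> 'y \<Rightarrow> 'y) \<Rightarrow> 'g \<Rightarrow> 'x \<times> 'y \<Rightarrow> 'x \<times> 'y" where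
  "prod_action L \<alpha> M \<beta> g = (\<lambda>(x, y)\<in>space L \<times> space M. (\<alpha> g x, \<beta> g y))"

lemma prod_action_apply [simp]:
  "x \<in> space L \<Longrightarrow> y \<in> space M \<Longrightarrow> prod_action L \<alpha> M \<beta> g (x, y) = (\<alpha> g x, \<beta> g y)"
  by (simp add: prod_action_def)

lemma diagonal_action_eq_prod_action:
  "diagonal_action L \<alpha> M \<beta> N \<gamma> = prod_action L \<alpha> (M \<Otimes>\<^sub>M N) (prod_action M \<beta> N \<gamma>)"
  by (auto simp: fun_eq_iff diagonal_action_def prod_action_def space_pair_measure restrict_def)

lemma measurable_prod_action:
  assumes "group G" "measurable_action G L \<alpha>" "measurable_action G M \<beta>"
  shows "measurable_action G (L \<Otimes>\<^sub>M M) (prod_action L \<alpha> M \<beta>)"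
  unfolding measurable_action_def
proof (intro conjI ballI)
  interpret group G by fact
  note L = measurable_actionD[OF assms(2)] and M = measurable_actionD[OF assms(3)]
  show "group_action G (space (L \<Otimes>\<^sub>M M)) (prod_action L \<alpha> M \<beta>)"
  proof (rule group_actionI[OF \<open>group G\<close>])
    show "prod_action L \<alpha> M \<beta> g \<in> extensional (space (L \<Otimes>\<^sub>M M))" for g
      by (simp add: prod_action_def space_pair_measure)
  qed (auto simp: space_pair_measure L M)
  fix g assume g: "g \<in> carrier G"
  note [measurable] = L(1)[OF g] M(1)[OF g]
  have "(\<lambda>z. (\<alpha> g (fst z), \<beta> g (snd z))) \<in> L \<Otimes>\<^sub>M M \<rightarrow>\<^sub>M L \<Otimes>\<^sub>M M" by measurable
  then show "prod_action L \<alpha> M \<beta> g \<in> L \<Otimes>\<^sub>M M \<rightarrow>\<^sub>M L \<Otimes>\<^sub>M M"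
    by (rule measurable_cong[THEN iffD1, rotated]) (auto simp: space_pair_measure)
qed

text \<open>Almost every section of a null set of the product is null, so quasi-invariance can be
  used one coordinate at a time: first \<alpha> moves \<open>x\<close>, then \<beta> moves
  \<open>y\<close>. This makes preimages of null sets null.\<close>

lemma measure_class_preserving_prod_action:
  assumes "group G" "prob_space L" "prob_space M"
    and L: "measure_class_preserving G L \<alpha>" and M: "measure_class_preserving G M \<beta>"
  shows "measure_class_preserving G (L \<Otimes>\<^sub>M M) (prod_action L \<alpha> M \<beta>)"
proof -
  interpret group G by fact
  interpret L: prob_space L by fact
  interpret M: prob_space M by fact
  interpret P: pair_prob_space L M ..
  let ?T = "prod_action L \<alpha> M \<beta>"
  have act: "measurable_action G (L \<Otimes>\<^sub>M M) ?T"
    using assms by (intro measurable_prod_action) (auto simp: measure_class_preserving_def)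
  note T = measurable_actionD[OF act]
  have null: "?T g -` N \<inter> space (L \<Otimes>\<^sub>M M) \<in> null_sets (L \<Otimes>\<^sub>M M)"
    if N: "N \<in> null_sets (L \<Otimes>\<^sub>M M)" and g: "g \<in> carrier G" for N g
  proof -
    have m: "?T g -` N \<inter> space (L \<Otimes>\<^sub>M M) \<in> sets (L \<Otimes>\<^sub>M M)"
      using T(1)[OF g] N by (intro measurable_sets) auto
    have "AE x in L. AE y in M. (x, y) \<notin> N"
      using P.AE_pair[OF AE_not_in[OF N]] .
    then have "AE x in L. AE y in M. (\<alpha> g x, y) \<notin> N"
      by (rule measure_class_preserving_AE[OF L g])
    then have "AE x in L. AE y in M. (\<alpha> g x, \<beta> g y) \<notin> N"
      by eventually_elim (rule measure_class_preserving_AE[OF M g])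
    then have "AE x in L. AE y in M. (x, y) \<notin> ?T g -` N \<inter> space (L \<Otimes>\<^sub>M M)"
      using AE_space
    proof eventually_elim
      case (elim x)
      show ?case using elim(1) AE_space by eventually_elim (use elim(2) in auto)
    qed
    then have "AE z in L \<Otimes>\<^sub>M M. z \<notin> ?T g -` N \<inter> space (L \<Otimes>\<^sub>M M)"
      using m by (intro P.AE_pair_measure sets.sets_Collect_neg) (auto simp del: vimage_eq Int_iff)
    then show ?thesis using m by (simp add: AE_iff_null_sets)
  qed
  have "null_sets (distr (L \<Otimes>\<^sub>M M) (L \<Otimes>\<^sub>M M) (?T g)) = null_sets (L \<Otimes>\<^sub>M M)" if g: "g \<in> carrier G" for g
  proof (intro equalityI subsetI)
    fix N assume "N \<in> null_sets (distr (L \<Otimes>\<^sub>M M) (L \<Otimes>\<^sub>M M) (?T g))"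
    then have N: "?T g -` N \<inter> space (L \<Otimes>\<^sub>M M) \<in> null_sets (L \<Otimes>\<^sub>M M)" "N \<in> sets (L \<Otimes>\<^sub>M M)"
      using T(1)[OF g] by (auto simp: null_sets_distr_iff)
    \<comment> \<open>Pulling back by \<open>g\<close> and then by its inverse recovers
      \<open>N\<close>, so \<open>null\<close> at the inverse element gives the other
      inclusion.\<close>
    have "?T (inv\<^bsub>G\<^esub> g) -` (?T g -` N \<inter> space (L \<Otimes>\<^sub>M M)) \<inter> space (L \<Otimes>\<^sub>M M) = N"
    proof (intro equalityI subsetI)
      fix z assume "z \<in> N"
      then show "z \<in> ?T (inv\<^bsub>G\<^esub> g) -` (?T g -` N \<inter> space (L \<Otimes>\<^sub>M M)) \<inter> space (L \<Otimes>\<^sub>M M)"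
        using T(2)[of "inv\<^bsub>G\<^esub> g" z] T(5)[OF g, of z] g sets.sets_into_space[OF N(2)] by auto
    next
      fix z assume "z \<in> ?T (inv\<^bsub>G\<^esub> g) -` (?T g -` N \<inter> space (L \<Otimes>\<^sub>M M)) \<inter> space (L \<Otimes>\<^sub>M M)"
      then have "?T g (?T (inv\<^bsub>G\<^esub> g) z) \<in> N" "z \<in> space (L \<Otimes>\<^sub>M M)" by auto
      then show "z \<in> N" using T(5)[OF g, of z] by simp
    qed
    then show "N \<in> null_sets (L \<Otimes>\<^sub>M M)"
      using null[OF N(1), of "inv\<^bsub>G\<^esub> g"] g by simp
  next
    fix N assume "N \<in> null_sets (L \<Otimes>\<^sub>M M)"
    then show "N \<in> null_sets (distr (L \<Otimes>\<^sub>M M) (L \<Otimes>\<^sub>M M) (?T g))"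
      using null[OF _ g] T(1)[OF g] by (auto simp: null_sets_distr_iff)
  qed
  with act show ?thesis by (simp add: measure_class_preserving_def)
qed

section \<open>Stationarity and almost everywhere invariance\<close>

text \<open>A \<open>(G, \<mu>)\<close>-space averages over \<open>g\<inverse>\<close>; here the average is over \<open>g\<close>, so this is
  stationarity of a \<open>G\<close>-space for the reflected measure.\<close>

definition forward_stationary ::
    "'g pmf \<Rightarrow> 'x measure \<Rightarrow> ('g \<Rightarrow> 'x \<Rightarrow> 'x) \<Rightarrow> bool" where
  "forward_stationary \<mu> M \<alpha> \<longleftrightarrow>
     (\<forall>\<phi> C. \<phi> \<in> borel_measurable M \<longrightarrow> (\<forall>x\<in>space M. \<bar>\<phi> x\<bar> \<le> C) \<longrightarrow>
        (\<integral>g. (\<integral>x. \<phi> (\<alpha> g x) \<partial>M) \<partial>measure_pmf \<mu>) = (\<integral>x. (\<phi> x :: real) \<partial>M))"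

text \<open>Expanding the square and using \<open>harm\<close> in the cross term turns the variance
  at \<open>x\<close> into the mean of the squares of \<Phi> at the translates of \<open>x\<close>,
  minus the square of \<open>\<Phi> x\<close>. Both terms have the same integral over
  \<open>M\<close>, by stationarity tested on the square of \<Phi>.\<close>

lemma forward_stationary_AE_invariant:
  fixes \<Phi> :: "'x \<Rightarrow> real"
  assumes "measured_group G \<mu>" "prob_space M" "measure_class_preserving G M \<alpha>"
    and stat: "forward_stationary \<mu> M \<alpha>"
    and \<Phi>: "\<Phi> \<in> borel_measurable M" "\<And>x. x \<in> space M \<Longrightarrow> \<bar>\<Phi> x\<bar> \<le> C"
    and harm: "\<And>x. x \<in> space M \<Longrightarrow> (\<integral>g. \<Phi> (\<alpha> g x) \<partial>measure_pmf \<mu>) = \<Phi> x"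
  shows "AE x in M. \<forall>g\<in>carrier G. \<Phi> (\<alpha> g x) = \<Phi> x"
proof -
  interpret group G using assms by (simp add: measured_group_def)
  interpret M: prob_space M by fact
  have sub: "set_pmf \<mu> \<subseteq> carrier G" and gen: "semigroup_generated G (set_pmf \<mu>) = carrier G"
    and count: "countable (carrier G)"
    using assms by (auto simp: measured_group_def)
  have act: "measurable_action G M \<alpha>" using assms by (simp add: measure_class_preserving_def)
  note A = measurable_actionD[OF act]
  have \<Phi>m: "(\<lambda>x. \<Phi> (\<alpha> g x)) \<in> borel_measurable M" if "g \<in> carrier G" for g
    using measurable_compose[OF A(1)[OF that] \<Phi>(1)] .
  have C: "\<bar>\<Phi> (\<alpha> g x)\<bar> \<le> C" if "g \<in> carrier G" "x \<in> space M" for g x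
    using \<Phi>(2) A(2) that by blast
  have sq: "\<bar>a\<^sup>2\<bar> \<le> C\<^sup>2" if "\<bar>a\<bar> \<le> C" for a :: real
    using power_mono[OF that, of 2] by simp
  have D: "\<bar>(\<Phi> (\<alpha> g x) - \<Phi> x)\<^sup>2\<bar> \<le> (2 * C)\<^sup>2" if "g \<in> carrier G" "x \<in> space M" for g x
  proof -
    have "\<bar>\<Phi> (\<alpha> g x) - \<Phi> x\<bar> \<le> 2 * C" using C[OF that] \<Phi>(2)[OF that(2)] by linarith
    from power_mono[OF this, of 2] show ?thesis by simp
  qed
  have int\<mu>: "integrable (measure_pmf \<mu>) f" if "\<And>g. g \<in> set_pmf \<mu> \<Longrightarrow> \<bar>f g\<bar> \<le> K" for f :: "'a \<Rightarrow> real" and K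
    by (rule measure_pmf.integrable_const_bound[of _ K]) (use that in \<open>auto intro!: AE_pmfI\<close>)
  have intM: "integrable M f" if "f \<in> borel_measurable M" "\<And>x. x \<in> space M \<Longrightarrow> \<bar>f x\<bar> \<le> K" for f :: "'x \<Rightarrow> real" and K
    by (rule M.integrable_const_bound[of _ K]) (use that in auto)
  have i2: "integrable M (\<lambda>x. (\<Phi> x)\<^sup>2)"
    by (rule intM[of _ "C\<^sup>2"]) (use \<Phi> sq in auto)
  have iD: "integrable M (\<lambda>x. (\<Phi> (\<alpha> g x) - \<Phi> x)\<^sup>2)" if "g \<in> carrier G" for g
    by (rule intM[of _ "(2 * C)\<^sup>2"]) (use \<Phi> \<Phi>m D that in auto)
  have point: "(\<integral>g. (\<Phi> (\<alpha> g x) - \<Phi> x)\<^sup>2 \<partial>measure_pmf \<mu>) = (\<integral>g. (\<Phi> (\<alpha> g x))\<^sup>2 \<partial>measure_pmf \<mu>) - (\<Phi> x)\<^sup>2"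
    if x: "x \<in> space M" for x
  proof -
    have 1: "integrable (measure_pmf \<mu>) (\<lambda>g. (\<Phi> (\<alpha> g x))\<^sup>2)"
      by (rule int\<mu>[of _ "C\<^sup>2"]) (use C x sub sq in auto)
    have 2: "integrable (measure_pmf \<mu>) (\<lambda>g. \<Phi> (\<alpha> g x))"
      by (rule int\<mu>[of _ C]) (use C x sub in auto)
    have "(\<integral>g. (\<Phi> (\<alpha> g x) - \<Phi> x)\<^sup>2 \<partial>measure_pmf \<mu>) =
        (\<integral>g. (\<Phi> (\<alpha> g x))\<^sup>2 + (- 2 * \<Phi> x) * \<Phi> (\<alpha> g x) + (\<Phi> x)\<^sup>2 \<partial>measure_pmf \<mu>)"
      by (simp add: power2_diff algebra_simps)
    also have "\<dots> = (\<integral>g. (\<Phi> (\<alpha> g x))\<^sup>2 \<partial>measure_pmf \<mu>) + (- 2 * \<Phi> x) * \<Phi> x + (\<Phi> x)\<^sup>2"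
      using 1 2 by (simp add: harm[OF x])
    finally show ?thesis by (simp add: power2_eq_square)
  qed
  have m2: "(\<lambda>x. \<integral>g. (\<Phi> (\<alpha> g x))\<^sup>2 \<partial>measure_pmf \<mu>) \<in> borel_measurable M"
    by (rule borel_measurable_integral_pmf[of _ _ _ "C\<^sup>2"]) (use \<Phi>m C sub sq M.prob_space_axioms in auto)
  have swap2: "(\<integral>g. \<integral>x. (\<Phi> (\<alpha> g x))\<^sup>2 \<partial>M \<partial>measure_pmf \<mu>) = (\<integral>x. \<integral>g. (\<Phi> (\<alpha> g x))\<^sup>2 \<partial>measure_pmf \<mu> \<partial>M)"
    by (rule integral_pmf_swap[of _ _ _ "C\<^sup>2"]) (use \<Phi>m C sub sq M.prob_space_axioms in auto)
  have stat2: "(\<integral>g. \<integral>x. (\<Phi> (\<alpha> g x))\<^sup>2 \<partial>M \<partial>measure_pmf \<mu>) = (\<integral>x. (\<Phi> x)\<^sup>2 \<partial>M)"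
    using stat[unfolded forward_stationary_def, rule_format, of "\<lambda>x. (\<Phi> x)\<^sup>2" "C\<^sup>2"] \<Phi> sq by simp
  have ig2: "integrable M (\<lambda>x. \<integral>g. (\<Phi> (\<alpha> g x))\<^sup>2 \<partial>measure_pmf \<mu>)"
  proof (rule intM[of _ "C\<^sup>2", OF m2])
    fix x assume x: "x \<in> space M"
    have "(\<integral>g. (\<Phi> (\<alpha> g x))\<^sup>2 \<partial>measure_pmf \<mu>) \<le> C\<^sup>2"
      by (rule measure_pmf.integral_le_const)
         (use C x sub sq in \<open>auto intro!: AE_pmfI int\<mu>[of _ "C\<^sup>2"] order_trans[OF abs_ge_self sq]\<close>)
    then show "\<bar>\<integral>g. (\<Phi> (\<alpha> g x))\<^sup>2 \<partial>measure_pmf \<mu>\<bar> \<le> C\<^sup>2" by simp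
  qed
  have "(\<integral>g. \<integral>x. (\<Phi> (\<alpha> g x) - \<Phi> x)\<^sup>2 \<partial>M \<partial>measure_pmf \<mu>)
      = (\<integral>x. \<integral>g. (\<Phi> (\<alpha> g x) - \<Phi> x)\<^sup>2 \<partial>measure_pmf \<mu> \<partial>M)"
    by (rule integral_pmf_swap[of _ _ _ "(2 * C)\<^sup>2"]) (use \<Phi> \<Phi>m D sub M.prob_space_axioms in auto)
  also have "\<dots> = (\<integral>x. (\<integral>g. (\<Phi> (\<alpha> g x))\<^sup>2 \<partial>measure_pmf \<mu>) - (\<Phi> x)\<^sup>2 \<partial>M)"
    by (intro Bochner_Integration.integral_cong refl point)
  also have "\<dots> = 0"
    using ig2 i2 swap2 stat2 by simp
  finally have zero: "(\<integral>g. \<integral>x. (\<Phi> (\<alpha> g x) - \<Phi> x)\<^sup>2 \<partial>M \<partial>measure_pmf \<mu>) = 0" .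
  have bd: "(\<integral>x. (\<Phi> (\<alpha> g x) - \<Phi> x)\<^sup>2 \<partial>M) \<le> (2 * C)\<^sup>2" if "g \<in> carrier G" for g
    by (rule M.integral_le_const[OF iD[OF that]])
       (use D[OF that] in \<open>auto intro!: AE_I2 order_trans[OF abs_ge_self]\<close>)
  \<comment> \<open>Nonnegativity is used twice: here for the outer integral over the group, then in
    \<open>supp\<close> for the inner one over \<open>M\<close>. Points of the support have positive
    mass, so no \<open>g\<close> in it is exceptional.\<close>
  have ae0: "AE g in measure_pmf \<mu>. (\<integral>x. (\<Phi> (\<alpha> g x) - \<Phi> x)\<^sup>2 \<partial>M) = 0"
    using zero by (subst (asm) integral_nonneg_eq_0_iff_AE)
      (use sub bd in \<open>auto intro!: int\<mu>[of _ "(2 * C)\<^sup>2"]\<close>)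
  have supp: "AE x in M. \<Phi> (\<alpha> g x) = \<Phi> x" if "g \<in> set_pmf \<mu>" for g
  proof -
    have "(\<integral>x. (\<Phi> (\<alpha> g x) - \<Phi> x)\<^sup>2 \<partial>M) = 0"
      using ae0 that by (simp add: AE_measure_pmf_iff)
    then show ?thesis
      using that sub iD[of g] by (subst (asm) integral_nonneg_eq_0_iff_AE) auto
  qed
  \<comment> \<open>The support generates the group as a semigroup, so induction over products
    reaches every element.\<close>
  have "AE x in M. \<Phi> (\<alpha> g x) = \<Phi> x" if "g \<in> carrier G" for g
    using that unfolding gen[symmetric]
  proof induction
    case (incl s)
    then show ?case by (rule supp)
  next
    case (mult a b)
    have ab: "a \<in> carrier G" "b \<in> carrier G" using mult.hyps gen by auto
    \<comment> \<open>The identity for \<open>a\<close> is needed at the translate of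
      \<open>x\<close> by \<open>b\<close>; quasi-invariance keeps the exceptional set null.\<close>
    have "AE x in M. \<Phi> (\<alpha> a (\<alpha> b x)) = \<Phi> (\<alpha> b x)"
      using measure_class_preserving_AE[OF assms(3) ab(2) mult.IH(1)] .
    then show ?case using mult.IH(2) AE_space by eventually_elim (simp add: A(3) ab)
  qed
  \<comment> \<open>There is one exceptional null set for each of countably many elements, so a
    single null set serves them all.\<close>
  then show ?thesis using count by (simp add: AE_ball_countable)
qed

section \<open>The extension principle\<close>

text \<open>The constant function 1 has transform 1, so the transform of \<phi> minus
  \<open>c\<close> vanishes, and by the isometry so does its essential supremum norm.\<close>

lemma poisson_boundary_constant:
  assumes pb: "poisson_boundary G \<mu> M \<alpha>" and "group G"
    and \<phi>: "\<phi> \<in> borel_measurable M" "\<And>x. x \<in> space M \<Longrightarrow> \<bar>\<phi> x\<bar> \<le> C"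
    and const: "\<And>g. g \<in> carrier G \<Longrightarrow> poisson_transform G M \<alpha> \<phi> g = c"
  shows "AE x in M. \<phi> x = c"
proof -
  interpret group G by fact
  interpret M: prob_space M using pb by (simp add: poisson_boundary_def measured_group_space_def)
  \<comment> \<open>The factors 1 fit the linearity clause of \<open>poisson_boundary\<close>, with
    the constant function 1 as the second function.\<close>
  define \<psi> where "\<psi> = (\<lambda>x. 1 * \<phi> x + (- c) * 1)"
  have "\<bar>\<psi> x\<bar> \<le> C + \<bar>c\<bar>" if "x \<in> space M" for x
    using \<phi>(2)[OF that] by (simp add: \<psi>_def)
  moreover have "\<psi> \<in> borel_measurable M" using \<phi>(1) by (simp add: \<psi>_def)
  ultimately have L: "\<phi> \<in> Linfty M" "(\<lambda>x. 1) \<in> Linfty M" "\<psi> \<in> Linfty M"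
    using \<phi> by (auto intro: bounded_in_Linfty)
  have lin: "\<forall>\<phi>\<in>Linfty M. \<forall>\<psi>\<in>Linfty M. \<forall>a b. \<forall>g\<in>carrier G.
      poisson_transform G M \<alpha> (\<lambda>x. a * \<phi> x + b * \<psi> x) g =
      a * poisson_transform G M \<alpha> \<phi> g + b * poisson_transform G M \<alpha> \<psi> g"
    using pb by (simp add: poisson_boundary_def)
  have one: "poisson_transform G M \<alpha> (\<lambda>x. 1) g = 1" if "g \<in> carrier G" for g
    using that by (simp add: poisson_transform_def M.prob_space)
  have "poisson_transform G M \<alpha> \<psi> g = 0" if "g \<in> carrier G" for g
  proof -
    have "poisson_transform G M \<alpha> \<psi> g = 1 * poisson_transform G M \<alpha> \<phi> g + (- c) * poisson_transform G M \<alpha> (\<lambda>x. 1) g"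
      using lin[rule_format, OF L(1,2) that, of 1 "- c"] by (simp add: \<psi>_def)
    then show ?thesis using const one that by simp
  qed
  \<comment> \<open>Nonemptiness of the carrier matters: in the extended reals the supremum of the
    empty set is minus infinity.\<close>
  then have "sup_norm G (poisson_transform G M \<alpha> \<psi>) = 0"
    using carrier_not_empty by (simp add: sup_norm_def)
  then have "Linfty_norm M \<psi> = 0"
    using pb L by (simp add: poisson_boundary_def)
  from Linfty_norm_eq_0_AE[OF this] show ?thesis by (simp add: \<psi>_def)
qed

text \<open>Invariance trades the inverse translation in the Poisson transform for a forward
  translation on \<xi>; this is why stationarity of the second factor is asked in forward
  form.\<close>

lemma ergodic_action_poisson_boundary_prod:
  assumes mg: "measured_group G \<mu>" and pb: "poisson_boundary G \<mu> m \<alpha>"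
    and erg: "ergodic_action G \<xi> \<delta>" and stat: "forward_stationary \<mu> \<xi> \<delta>"
  shows "ergodic_action G (m \<Otimes>\<^sub>M \<xi>) (prod_action m \<alpha> \<xi> \<delta>)"
proof -
  interpret group G using mg by (simp add: measured_group_def)
  have sub: "set_pmf \<mu> \<subseteq> carrier G" and count: "countable (carrier G)"
    using mg by (auto simp: measured_group_def)
  interpret m: prob_space m using pb by (simp add: poisson_boundary_def measured_group_space_def)
  interpret \<xi>: prob_space \<xi> using erg by (simp add: ergodic_action_def)
  interpret P: pair_prob_space m \<xi> ..
  have cm: "measure_class_preserving G m \<alpha>" and c\<xi>: "measure_class_preserving G \<xi> \<delta>"
    using pb erg by (auto simp: poisson_boundary_def measured_group_space_def ergodic_action_def)
  then have am: "measurable_action G m \<alpha>" and a\<xi>: "measurable_action G \<xi> \<delta>"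
    by (auto simp: measure_class_preserving_def)
  have stat_m: "\<forall>\<phi>\<in>Linfty m.
      (\<integral>g. (\<integral>x. \<phi> (\<alpha> (inv\<^bsub>G\<^esub> g) x) \<partial>m) \<partial>measure_pmf \<mu>) = (\<integral>x. \<phi> x \<partial>m)"
    using pb by (simp add: poisson_boundary_def measured_group_space_def)
  note A = measurable_actionD[OF am] and D = measurable_actionD[OF a\<xi>]
  have null_or_conull: "S \<in> null_sets (m \<Otimes>\<^sub>M \<xi>) \<or> space (m \<Otimes>\<^sub>M \<xi>) - S \<in> null_sets (m \<Otimes>\<^sub>M \<xi>)"
    if S: "S \<in> sets (m \<Otimes>\<^sub>M \<xi>)" and inv: "\<forall>g\<in>carrier G. prod_action m \<alpha> \<xi> \<delta> g ` S = S" for S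
  proof -
    have into: "(\<alpha> g b, \<delta> g x) \<in> S" if "(b, x) \<in> S" "g \<in> carrier G" for b x g
    proof -
      have "b \<in> space m" "x \<in> space \<xi>"
        using that sets.sets_into_space[OF S] by (auto simp: space_pair_measure)
      then have "(\<alpha> g b, \<delta> g x) = prod_action m \<alpha> \<xi> \<delta> g (b, x)" by simp
      then show ?thesis using inv that by (metis image_eqI)
    qed
    \<comment> \<open>Acting by \<open>g\<close> on the left pair gives the right one, and acting by
      its inverse leads back.\<close>
    have iff: "(\<alpha> (inv\<^bsub>G\<^esub> g) b, x) \<in> S \<longleftrightarrow> (b, \<delta> g x) \<in> S"
      if "b \<in> space m" "x \<in> space \<xi>" "g \<in> carrier G" for b x g
      using into[of "\<alpha> (inv\<^bsub>G\<^esub> g) b" x g] into[of b "\<delta> g x" "inv\<^bsub>G\<^esub> g"] that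
      by (auto simp: A D)
    define \<Phi> where "\<Phi> x = (\<integral>b. indicator S (b, x) \<partial>m :: real)" for x
    have F: "(\<lambda>b. indicator S (b, x) :: real) \<in> borel_measurable m" if "x \<in> space \<xi>" for x
      using S that by measurable
    have \<Phi>m [measurable]: "\<Phi> \<in> borel_measurable \<xi>"
    proof -
      note S [measurable]
      have "(\<lambda>(x, b). indicator S (b, x) :: real) \<in> borel_measurable (\<xi> \<Otimes>\<^sub>M m)" by measurable
      then show ?thesis unfolding \<Phi>_def by (rule m.borel_measurable_lebesgue_integral)
    qed
    have \<Phi>01: "0 \<le> \<Phi> x" "\<Phi> x \<le> 1" if "x \<in> space \<xi>" for x
      unfolding \<Phi>_def
      by (auto intro!: m.integral_le_const m.integrable_const_bound[of _ 1] F that AE_I2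
          split: split_indicator)
    \<comment> \<open>On the carrier this integral is the Poisson transform of the indicator of the
      section of \<open>S\<close> at \<open>x\<close>.\<close>
    have PT: "(\<integral>b. indicator S (\<alpha> (inv\<^bsub>G\<^esub> g) b, x) \<partial>m) = \<Phi> (\<delta> g x)" if "x \<in> space \<xi>" "g \<in> carrier G" for x g
      unfolding \<Phi>_def by (intro Bochner_Integration.integral_cong refl) (simp add: indicator_def iff that)
    \<comment> \<open>Stationarity of \<open>m\<close>, tested on the indicator of a section, gives
      this at every point \<open>x\<close>, not merely at almost every one.\<close>
    have harm: "(\<integral>g. \<Phi> (\<delta> g x) \<partial>measure_pmf \<mu>) = \<Phi> x" if x: "x \<in> space \<xi>" for x
    proof -
      have "(\<lambda>b. indicator S (b, x) :: real) \<in> Linfty m"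
        by (rule bounded_in_Linfty[OF F[OF x], of 1]) (simp add: indicator_def)
      then have "(\<integral>g. (\<integral>b. indicator S (\<alpha> (inv\<^bsub>G\<^esub> g) b, x) \<partial>m) \<partial>measure_pmf \<mu>) = \<Phi> x"
        unfolding \<Phi>_def by (rule bspec[OF stat_m])
      moreover have "(\<integral>g. (\<integral>b. indicator S (\<alpha> (inv\<^bsub>G\<^esub> g) b, x) \<partial>m) \<partial>measure_pmf \<mu>) = (\<integral>g. \<Phi> (\<delta> g x) \<partial>measure_pmf \<mu>)"
        using sub x by (intro integral_cong_AE) (auto intro!: AE_pmfI PT)
      ultimately show ?thesis by simp
    qed
    have ae: "AE x in \<xi>. \<forall>g\<in>carrier G. \<Phi> (\<delta> g x) = \<Phi> x"
      using \<Phi>01 by (intro forward_stationary_AE_invariant[OF mg \<xi>.prob_space_axioms c\<xi> stat \<Phi>m, of 1] harm) auto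
    \<comment> \<open>Ergodicity is stated for strictly invariant sets. Building the invariance of
      \<Phi> along the whole orbit into \<open>E\<close> makes \<open>E\<close> strictly invariant,
      whereas the set where \<Phi> is 1 might be so only up to a null set.\<close>
    define E where "E = {x \<in> space \<xi>. (\<forall>g\<in>carrier G. \<Phi> (\<delta> g x) = \<Phi> x) \<and> \<Phi> x = 1}"
    have E: "E \<in> sets \<xi>"
    proof -
      have [measurable]: "(\<lambda>x. \<Phi> (\<delta> g x)) \<in> borel_measurable \<xi>" if "g \<in> carrier G" for g
        using measurable_compose[OF D(1)[OF that] \<Phi>m] .
      have "{x \<in> space \<xi>. \<forall>g\<in>carrier G. \<Phi> (\<delta> g x) = \<Phi> x} \<in> sets \<xi>"
        by (intro sets.sets_Collect_countable_All' count) measurable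
      moreover have "{x \<in> space \<xi>. \<Phi> x = 1} \<in> sets \<xi>" by measurable
      ultimately show ?thesis unfolding E_def by (intro sets.sets_Collect_conj)
    qed
    have Einv: "\<delta> g x \<in> E" if "x \<in> E" "g \<in> carrier G" for x g
      using that by (auto simp: E_def D(2) D(3)[symmetric])
    have "\<delta> g ` E = E" if g: "g \<in> carrier G" for g
    proof (intro equalityI subsetI)
      fix x assume x: "x \<in> E"
      then have "x = \<delta> g (\<delta> (inv\<^bsub>G\<^esub> g) x)" using D(5)[OF g] by (simp add: E_def)
      then show "x \<in> \<delta> g ` E" using Einv[OF x, of "inv\<^bsub>G\<^esub> g"] g by auto
    qed (use Einv g in auto)
    then have dich: "E \<in> null_sets \<xi> \<or> space \<xi> - E \<in> null_sets \<xi>"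
      using erg E by (simp add: ergodic_action_def)
    \<comment> \<open>The transform of the section is constant here, so its indicator equals
      \<open>\<Phi> x\<close> almost everywhere. As \<open>m\<close> has mass 1, equality holds at
      some point, where the indicator is 0 or 1.\<close>
    have zero_one: "\<Phi> x = 0 \<or> \<Phi> x = 1"
      if x: "x \<in> space \<xi>" and "\<forall>g\<in>carrier G. \<Phi> (\<delta> g x) = \<Phi> x" for x
    proof -
      have "AE b in m. indicator S (b, x) = \<Phi> x"
        by (rule poisson_boundary_constant[OF pb group_axioms F[OF x], of 1])
           (use that PT in \<open>auto simp: poisson_transform_def indicator_def\<close>)
      then have "\<exists>b. indicator S (b, x) = \<Phi> x"
        using m.AE_contr by (metis (mono_tags, lifting) eventually_mono)
      then show ?thesis by (metis indicator_simps)
    qed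
    have int: "integrable (m \<Otimes>\<^sub>M \<xi>) (indicator S :: _ \<Rightarrow> real)"
      using S by (intro P.integrable_const_bound[of _ 1]) (auto simp: indicator_def)
    \<comment> \<open>By Fubini it remains to see that \<Phi> is almost everywhere 0 when
      \<open>E\<close> is null, and almost everywhere 1 when \<open>E\<close> is conull.\<close>
    have meas: "measure (m \<Otimes>\<^sub>M \<xi>) S = (\<integral>x. \<Phi> x \<partial>\<xi>)"
      using P.integral_snd[of "\<lambda>b x. indicator S (b, x) :: real"] int S by (simp add: \<Phi>_def)
    from dich show ?thesis
    proof
      assume "E \<in> null_sets \<xi>"
      then have "AE x in \<xi>. x \<notin> E" by (rule AE_not_in)
      then have "AE x in \<xi>. \<Phi> x = 0"
        using ae AE_space by eventually_elim (use zero_one in \<open>auto simp: E_def\<close>)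
      then have "(\<integral>x. \<Phi> x \<partial>\<xi>) = 0" by (rule integral_eq_zero_AE)
      then show ?thesis using meas S by (simp add: null_sets_def P.emeasure_eq_measure)
    next
      assume "space \<xi> - E \<in> null_sets \<xi>"
      then have "AE x in \<xi>. x \<notin> space \<xi> - E" by (rule AE_not_in)
      then have "AE x in \<xi>. \<Phi> x = 1"
        using AE_space by eventually_elim (auto simp: E_def)
      then have "(\<integral>x. \<Phi> x \<partial>\<xi>) = (\<integral>x. 1 \<partial>\<xi>)" by (intro integral_cong_AE) auto
      then have "measure (m \<Otimes>\<^sub>M \<xi>) (space (m \<Otimes>\<^sub>M \<xi>) - S) = 0"
        using meas S by (simp add: P.prob_compl \<xi>.prob_space)
      then show ?thesis using S by (auto simp: null_sets_def P.emeasure_eq_measure)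
    qed
  qed
  then show ?thesis
    unfolding ergodic_action_def
    using measure_class_preserving_prod_action[OF group_axioms m.prob_space_axioms \<xi>.prob_space_axioms cm c\<xi>]
      P.prob_space_axioms by blast
qed

section \<open>The reflected measure and stationarity of products\<close>

text \<open>Inversion reverses products, so it carries words in the support of \<mu> to words in the
  inverted support, and it maps the group onto itself.\<close>

lemma measured_group_reflected_pmf:
  assumes "measured_group G \<mu>"
  shows "measured_group G (reflected_pmf G \<mu>)"
proof -
  interpret group G using assms by (simp add: measured_group_def)
  have sub: "set_pmf \<mu> \<subseteq> carrier G" and gen: "semigroup_generated G (set_pmf \<mu>) = carrier G"
    using assms by (auto simp: measured_group_def)
  let ?R = "set_pmf (reflected_pmf G \<mu>)"
  have R: "?R = (\<lambda>g. inv\<^bsub>G\<^esub> g) ` set_pmf \<mu>" by (simp add: reflected_pmf_def)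
  have "g \<in> carrier G" if "g \<in> semigroup_generated G ?R" for g
    using that by induction (use sub R in auto)
  moreover have "inv\<^bsub>G\<^esub> g \<in> semigroup_generated G ?R" if "g \<in> semigroup_generated G (set_pmf \<mu>)" for g
    using that
  proof induction
    case (incl s)
    then show ?case using R by (auto intro: semigroup_generated.incl)
  next
    case (mult a b)
    then have "a \<in> carrier G" "b \<in> carrier G" using gen by auto
    then show ?case using mult.IH by (simp add: inv_mult_group semigroup_generated.mult)
  qed
  then have "g \<in> semigroup_generated G ?R" if "g \<in> carrier G" for g
    using that gen by (metis inv_closed inv_inv)
  ultimately show ?thesis
    using assms sub R by (auto simp: measured_group_def)
qed

lemma forward_stationary_measure_preserving:
  assumes "measure_preserving_action G M \<alpha>" "set_pmf \<mu> \<subseteq> carrier G"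
  shows "forward_stationary \<mu> M \<alpha>"
  unfolding forward_stationary_def
proof (intro allI impI)
  fix \<phi> :: "_ \<Rightarrow> real" and C assume \<phi>: "\<phi> \<in> borel_measurable M"
  have "(\<integral>x. \<phi> (\<alpha> g x) \<partial>M) = (\<integral>x. \<phi> x \<partial>M)" if "g \<in> carrier G" for g
  proof -
    have m: "\<alpha> g \<in> M \<rightarrow>\<^sub>M M" and d: "distr M M (\<alpha> g) = M"
      using assms that by (auto simp: measure_preserving_action_def measurable_action_def)
    show ?thesis using integral_distr[OF m \<phi>] d by simp
  qed
  then have "(\<integral>g. (\<integral>x. \<phi> (\<alpha> g x) \<partial>M) \<partial>measure_pmf \<mu>) = (\<integral>g. (\<integral>x. \<phi> x \<partial>M) \<partial>measure_pmf \<mu>)"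
    using assms by (intro integral_cong_AE) (auto intro!: AE_pmfI)
  then show "(\<integral>g. (\<integral>x. \<phi> (\<alpha> g x) \<partial>M) \<partial>measure_pmf \<mu>) = (\<integral>x. \<phi> x \<partial>M)" by simp
qed

text \<open>The inverse in the definition of a \<mu>-space cancels the one in the reflection. This
  is what makes the boundary of the reflected measure the right companion to the boundary of
  \<mu>.\<close>

lemma forward_stationary_reflected:
  assumes "measured_group G \<mu>" "measured_group_space G (reflected_pmf G \<mu>) M \<alpha>"
  shows "forward_stationary \<mu> M \<alpha>"
  unfolding forward_stationary_def
proof (intro allI impI)
  interpret group G using assms by (simp add: measured_group_def)
  have sub: "set_pmf \<mu> \<subseteq> carrier G" using assms by (simp add: measured_group_def)
  fix \<phi> :: "_ \<Rightarrow> real" and C assume "\<phi> \<in> borel_measurable M" "\<forall>x\<in>space M. \<bar>\<phi> x\<bar> \<le> C"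
  then have "\<phi> \<in> Linfty M" by (intro bounded_in_Linfty) auto
  then have "(\<integral>g. (\<integral>x. \<phi> (\<alpha> (inv\<^bsub>G\<^esub> (inv\<^bsub>G\<^esub> g)) x) \<partial>M) \<partial>measure_pmf \<mu>) = (\<integral>x. \<phi> x \<partial>M)"
    using assms(2) by (simp add: measured_group_space_def reflected_pmf_def)
  moreover have "(\<integral>g. (\<integral>x. \<phi> (\<alpha> (inv\<^bsub>G\<^esub> (inv\<^bsub>G\<^esub> g)) x) \<partial>M) \<partial>measure_pmf \<mu>) =
      (\<integral>g. (\<integral>x. \<phi> (\<alpha> g x) \<partial>M) \<partial>measure_pmf \<mu>)"
    using sub by (intro integral_cong_AE) (auto intro!: AE_pmfI)
  ultimately show "(\<integral>g. (\<integral>x. \<phi> (\<alpha> g x) \<partial>M) \<partial>measure_pmf \<mu>) = (\<integral>x. \<phi> x \<partial>M)" by simp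
qed

text \<open>Since \<beta> preserves \<open>M\<close>, the translation of \<open>y\<close> can be
  undone under the integral. For fixed \<open>y\<close> only an average over translates of
  \<open>x\<close> is left, to which stationarity of \<open>L\<close> applies.\<close>

lemma forward_stationary_prod:
  assumes "prob_space L" "prob_space M"
    and L: "measurable_action G L \<alpha>" "forward_stationary \<mu> L \<alpha>"
    and M: "measure_preserving_action G M \<beta>" and sub: "set_pmf \<mu> \<subseteq> carrier G"
  shows "forward_stationary \<mu> (L \<Otimes>\<^sub>M M) (prod_action L \<alpha> M \<beta>)"
  unfolding forward_stationary_def
proof (intro allI impI)
  interpret L: prob_space L by fact
  interpret M: prob_space M by fact
  interpret P: pair_prob_space L M ..
  have aM: "measurable_action G M \<beta>" using M by (simp add: measure_preserving_action_def)
  note A = measurable_actionD[OF L(1)] and B = measurable_actionD[OF aM]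
  fix \<phi> :: "_ \<Rightarrow> real" and C
  assume \<phi>[measurable]: "\<phi> \<in> borel_measurable (L \<Otimes>\<^sub>M M)" and C: "\<forall>x\<in>space (L \<Otimes>\<^sub>M M). \<bar>\<phi> x\<bar> \<le> C"
  define H where "H g y = (\<integral>x. \<phi> (\<alpha> g x, y) \<partial>L)" for g y
  have int: "integrable (L \<Otimes>\<^sub>M M) f" if "f \<in> borel_measurable (L \<Otimes>\<^sub>M M)"
    "\<And>z. z \<in> space (L \<Otimes>\<^sub>M M) \<Longrightarrow> \<bar>f z\<bar> \<le> C" for f :: "_ \<Rightarrow> real"
    by (rule P.integrable_const_bound[of _ C]) (use that in auto)
  have C': "\<bar>\<phi> (x, y)\<bar> \<le> C" if "x \<in> space L" "y \<in> space M" for x y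
    using C that by (auto simp: space_pair_measure)
  have Hm: "H g \<in> borel_measurable M" if "g \<in> carrier G" for g
  proof -
    note [measurable] = A(1)[OF that]
    show ?thesis unfolding H_def by measurable
  qed
  have Hb: "\<bar>H g y\<bar> \<le> C" if "g \<in> carrier G" "y \<in> space M" for g y
  proof -
    note [measurable] = A(1)[OF that(1)]
    have m: "(\<lambda>x. \<phi> (\<alpha> g x, y)) \<in> borel_measurable L" using that(2) by measurable
    have "integrable L (\<lambda>x. \<phi> (\<alpha> g x, y))"
      by (rule L.integrable_const_bound[of _ C]) (use that m in \<open>auto intro!: C' A\<close>)
    then have "\<bar>H g y\<bar> \<le> (\<integral>x. \<bar>\<phi> (\<alpha> g x, y)\<bar> \<partial>L)" unfolding H_def by (intro integral_abs_bound)
    also have "\<dots> \<le> C"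
      by (rule L.integral_le_const) (use \<open>integrable L _\<close> that in \<open>auto intro!: C' A\<close>)
    finally show ?thesis .
  qed
  have step: "(\<integral>z. \<phi> (prod_action L \<alpha> M \<beta> g z) \<partial>(L \<Otimes>\<^sub>M M)) = (\<integral>y. H g y \<partial>M)" if g: "g \<in> carrier G" for g
  proof -
    note [measurable] = A(1)[OF g] B(1)[OF g]
    have "(\<integral>z. \<phi> (prod_action L \<alpha> M \<beta> g z) \<partial>(L \<Otimes>\<^sub>M M)) = (\<integral>(x, y). \<phi> (\<alpha> g x, \<beta> g y) \<partial>(L \<Otimes>\<^sub>M M))"
      by (intro Bochner_Integration.integral_cong) (auto simp: space_pair_measure)
    also have "\<dots> = (\<integral>y. \<integral>x. \<phi> (\<alpha> g x, \<beta> g y) \<partial>L \<partial>M)"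
      by (rule P.integral_snd[symmetric]) (rule int, measurable, auto simp: space_pair_measure intro!: C' A B g)
    also have "\<dots> = (\<integral>y. H g (\<beta> g y) \<partial>M)" by (simp add: H_def)
    \<comment> \<open>Change of variables along \<open>\<beta> g\<close>; the image measure is
      \<open>M\<close> again.\<close>
    also have "\<dots> = (\<integral>y. H g y \<partial>distr M M (\<beta> g))"
      by (rule integral_distr[symmetric, OF B(1)[OF g] Hm[OF g]])
    finally show ?thesis using M g by (simp add: measure_preserving_action_def)
  qed
  have "(\<integral>g. (\<integral>z. \<phi> (prod_action L \<alpha> M \<beta> g z) \<partial>(L \<Otimes>\<^sub>M M)) \<partial>measure_pmf \<mu>) = (\<integral>g. (\<integral>y. H g y \<partial>M) \<partial>measure_pmf \<mu>)"
    using sub by (intro integral_cong_AE) (auto intro!: AE_pmfI step)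
  also have "\<dots> = (\<integral>y. (\<integral>g. H g y \<partial>measure_pmf \<mu>) \<partial>M)"
    by (rule integral_pmf_swap[of _ _ _ C]) (use Hm Hb sub assms(2) in auto)
  also have "\<dots> = (\<integral>y. (\<integral>x. \<phi> (x, y) \<partial>L) \<partial>M)"
  proof (intro Bochner_Integration.integral_cong refl)
    fix y assume y: "y \<in> space M"
    have "(\<lambda>x. \<phi> (x, y)) \<in> borel_measurable L" using y by measurable
    with L(2) C' y show "(\<integral>g. H g y \<partial>measure_pmf \<mu>) = (\<integral>x. \<phi> (x, y) \<partial>L)"
      unfolding H_def forward_stationary_def by blast
  qed
  also have "\<dots> = (\<integral>z. \<phi> z \<partial>(L \<Otimes>\<^sub>M M))"
    using P.integral_snd[of "\<lambda>x y. \<phi> (x, y)"] int[OF \<phi>] C by simp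
  finally show "(\<integral>g. (\<integral>z. \<phi> (prod_action L \<alpha> M \<beta> g z) \<partial>(L \<Otimes>\<^sub>M M)) \<partial>measure_pmf \<mu>) = (\<integral>z. \<phi> z \<partial>(L \<Otimes>\<^sub>M M))" .
qed

theorem theorem2p1:
  fixes G :: "('g, 'z) monoid_scheme" and \<mu> :: "'g pmf"
    and m :: "'b measure" and \<alpha> :: "'g \<Rightarrow> 'b \<Rightarrow> 'b"
    and m' :: "'c measure" and \<beta> :: "'g \<Rightarrow> 'c \<Rightarrow> 'c"
    and \<eta> :: "'y measure" and \<gamma> :: "'g \<Rightarrow> 'y \<Rightarrow> 'y"
  assumes "measured_group G \<mu>"
    and "poisson_boundary G \<mu> m \<alpha>"
    and "poisson_boundary G (reflected_pmf G \<mu>) m' \<beta>"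
    and "pmp_space G \<eta> \<gamma>" and "ergodic_action G \<eta> \<gamma>"
  shows "ergodic_action G (m \<Otimes>\<^sub>M m' \<Otimes>\<^sub>M \<eta>) (diagonal_action m \<alpha> m' \<beta> \<eta> \<gamma>)"
proof -
  have sub: "set_pmf \<mu> \<subseteq> carrier G" using assms(1) by (simp add: measured_group_def)
  have refl: "measured_group G (reflected_pmf G \<mu>)"
    using assms(1) by (rule measured_group_reflected_pmf)
  have \<eta>: "prob_space \<eta>" "measure_preserving_action G \<eta> \<gamma>"
    using assms(4) by (auto simp: pmp_space_def)
  have m': "prob_space m'" "measurable_action G m' \<beta>"
      "measured_group_space G (reflected_pmf G \<mu>) m' \<beta>"
    using assms(3)
    by (auto simp: poisson_boundary_def measured_group_space_def measure_class_preserving_def)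
  \<comment> \<open>The inner application uses the reflected measure in the role of \<mu>; \<eta>,
    being invariant, is stationary for it as well.\<close>
  have "ergodic_action G (m' \<Otimes>\<^sub>M \<eta>) (prod_action m' \<beta> \<eta> \<gamma>)"
    using refl assms(3,5)
  proof (rule ergodic_action_poisson_boundary_prod)
    show "forward_stationary (reflected_pmf G \<mu>) \<eta> \<gamma>"
      using \<eta>(2) refl by (intro forward_stationary_measure_preserving) (auto simp: measured_group_def)
  qed
  \<comment> \<open>The outer application adds the boundary of \<mu> itself, so stationarity of the
    inner product is now needed for \<mu>.\<close>
  moreover have "forward_stationary \<mu> (m' \<Otimes>\<^sub>M \<eta>) (prod_action m' \<beta> \<eta> \<gamma>)"
    using m'(1) \<eta>(1) m'(2) forward_stationary_reflected[OF assms(1) m'(3)] \<eta>(2) sub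
    by (rule forward_stationary_prod)
  ultimately show ?thesis
    unfolding diagonal_action_eq_prod_action
    by (rule ergodic_action_poisson_boundary_prod[OF assms(1,2)])
qed

end
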